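(* Let $n>k\geqslant 1$ be integers and let $\sigma\in S_n$. Then $\sigma$ is $k$-prolific if and only if $\mathrm{br}(\sigma)\geqslant k+2$.
   Context: $S_n$ is the set of permutations of $[n]=\{1,\dots,n\}$, written in one-line notation $\sigma=\sigma(1)\cdots\sigma(n)$. A permutation $\sigma\in S_n$ contains $\pi\in S_r$ (written $\pi\preceq\sigma$) if there are indices $i_1<\dots<i_r$ with $\sigma(i_1)\cdots\sigma(i_r)$ in the same relative order as $\pi$. For $n>k\geqslant1$, $\sigma\in S_n$ is $k$-prolific if $|\{\pi\in S_{n-k}:\pi\preceq\sigma\}|=\binom{n}{k}$. The distance between entries $i,j$ of $\sigma$ is $d_\sigma(i,j)=|i-j|+|\sigma(i)-\sigma(j)|$ (the $L_1$ distance between the points $(i,\sigma(i))$ and $(j,\sigma(j))$), and for $n>1$ the breadth of $\sigma$ is $\mathrm{br}(\sigma)=\min_{i\neq j} d_\sigma(i,j)$. *)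

theory Defs
  imports "HOL-Combinatorics.Permutations"
begin

text \<open>
  A member of \<open>Sym n\<close> is a function on all of \<open>nat\<close> that fixes every point outside \<open>{1..n}\<close>,
  so that distinct permutations of \<open>{1..n}\<close> are distinct functions and counting is meaningful.
\<close>

definition Sym :: "nat \<Rightarrow> (nat \<Rightarrow> nat) set" where
  "Sym n = {\<sigma>. \<sigma> permutes {1..n}}"

definition contained_in :: "nat \<Rightarrow> (nat \<Rightarrow> nat) \<Rightarrow> nat \<Rightarrow> (nat \<Rightarrow> nat) \<Rightarrow> bool" where
  "contained_in r \<pi> n \<sigma> \<longleftrightarrow>
     (\<exists>f. f ` {1..r} \<subseteq> {1..n} \<and> strict_mono_on {1..r} f \<and>
          (\<forall>a\<in>{1..r}. \<forall>b\<in>{1..r}. \<sigma> (f a) < \<sigma> (f b) \<longleftrightarrow> \<pi> a < \<pi> b))"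

definition prolific :: "nat \<Rightarrow> nat \<Rightarrow> (nat \<Rightarrow> nat) \<Rightarrow> bool" where
  "prolific k n \<sigma> \<longleftrightarrow>
     card {\<pi> \<in> Sym (n - k). contained_in (n - k) \<pi> n \<sigma>} = n choose k"

definition entry_dist :: "(nat \<Rightarrow> nat) \<Rightarrow> nat \<Rightarrow> nat \<Rightarrow> int" where
  "entry_dist \<sigma> i j = \<bar>int i - int j\<bar> + \<bar>int (\<sigma> i) - int (\<sigma> j)\<bar>"

text \<open>The minimum is over a nonempty set only for \<open>n > 1\<close>.\<close>

definition breadth :: "nat \<Rightarrow> (nat \<Rightarrow> nat) \<Rightarrow> int" where
  "breadth n \<sigma> = Min {entry_dist \<sigma> i j | i j. i \<in> {1..n} \<and> j \<in> {1..n} \<and> i \<noteq> j}"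

end

theory Submission
  imports Defs "HOL-Library.Infinite_Set"
begin

text \<open>
  The patterns of length \<open>n - k\<close> contained in \<open>\<sigma>\<close> are the patterns of the \<open>(n - k)\<close>-subsets of
  the entries, so \<open>\<sigma>\<close> is \<open>k\<close>-prolific iff distinct subsets have distinct patterns.

  If two entries \<open>i\<close>, \<open>j\<close> are at distance at most \<open>k + 1\<close>, at most \<open>k - 1\<close> entries lie strictly
  between them in position or in value. Once \<open>k - 1\<close> entries including all of these are deleted,
  deleting \<open>i\<close> or deleting \<open>j\<close> leaves the same pattern.

  Conversely, let \<open>A \<noteq> B\<close> have the same pattern and let \<open>\<phi> : A \<rightarrow> B\<close> be the order isomorphism. Up to
  reflection some point moves right and up, and tracing it back along \<open>\<phi>\<close> gives such a point in
  \<open>A - B\<close>. Counting deleted points bounds the horizontal plus the vertical displacement of \<open>x\<close> by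
  \<open>k\<close> plus the number of points of \<open>A - B\<close> that move right and up and lie below and to the left of
  \<open>\<phi> x\<close>. If all distances are at least \<open>k + 2\<close>, this number is at least 2. Along the antichain of
  minimal points of \<open>A - B\<close> moving right and up, one then finds \<open>x\<close>, \<open>x'\<close> that both lie below and
  to the left of both \<open>\<phi> x\<close> and \<open>\<phi> x'\<close>; the same counting, applied to the horizontal displacement
  of \<open>x\<close> and the vertical one of \<open>x'\<close>, shows that \<open>x\<close> and \<open>x'\<close> are at distance at most \<open>k\<close>.
\<close>

section \<open>Order isomorphisms between subsets of a spread point set\<close>

lemma card_between:
  fixes f :: "'a \<Rightarrow> int"
  assumes "inj_on f V" "a < b"
  shows "int (card {z \<in> V. a < f z \<and> f z < b}) \<le> b - a - 1"
proof -
  have "card {z \<in> V. a < f z \<and> f z < b} \<le> card {a<..<b}"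
    by (rule card_inj_on_le[where f = f]) (use assms in \<open>auto simp: inj_on_def\<close>)
  then show ?thesis using assms by simp
qed

text \<open>Only right-moving points and points in neither set occupy coordinates between \<open>x\<close> and \<open>\<phi> x\<close>;
  the right-moving points before \<open>x\<close> are as many as their images before \<open>\<phi> x\<close>.\<close>

lemma displacement_le:
  fixes p :: "'a \<Rightarrow> int"
  assumes fin: "finite V" and AV: "A \<subseteq> V" and BV: "B \<subseteq> V" and bij: "bij_betw \<phi> A B"
    and inj: "inj_on p V"
    and conv: "\<And>u v t. \<lbrakk>u \<in> V; v \<in> V; p u \<le> t; t \<le> p v\<rbrakk> \<Longrightarrow> t \<in> p ` V"
    and mono: "\<And>u v. \<lbrakk>u \<in> A; v \<in> A\<rbrakk> \<Longrightarrow> p (\<phi> u) < p (\<phi> v) \<longleftrightarrow> p u < p v"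
    and x: "x \<in> A" "p x < p (\<phi> x)"
  shows "p (\<phi> x) - p x \<le>
      int (card {e \<in> A - B. p e < p (\<phi> e) \<and> p e < p (\<phi> x)})
      + int (card {z \<in> V - A - B. p x < p z \<and> p z < p (\<phi> x)})"
proof -
  define R where "R = {u \<in> A. p u < p (\<phi> u)}"
  define W where "W = {z \<in> V. p x \<le> p z \<and> p z < p (\<phi> x)}"
  define L where "L = {z \<in> V. p z < p x}"
  define L' where "L' = {z \<in> V. p z < p (\<phi> x)}"
  define C where "C = {z \<in> V - A - B. p x < p z \<and> p z < p (\<phi> x)}"
  define F where "F = {e \<in> A - B. p e < p (\<phi> e) \<and> p e < p (\<phi> x)}"
  have phiB: "\<phi> u \<in> B" if "u \<in> A" for u using bij that by (auto simp: bij_betw_def)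
  have surj: "\<exists>u\<in>A. z = \<phi> u" if "z \<in> B" for z using bij that by (auto simp: bij_betw_def)
  have injphi: "inj_on \<phi> A" using bij by (auto simp: bij_betw_def)
  have finR: "finite R" using fin AV finite_subset unfolding R_def by fastforce
  have finsets: "finite W" "finite L" "finite L'" "finite C" "finite F"
    using fin AV finite_subset[of A V] unfolding W_def L_def L'_def C_def F_def by auto
  \<comment> \<open>No coordinate is skipped, so \<open>W\<close> has as many points as the
    displacement of \<open>x\<close>.\<close>
  have "p ` W = {p x..<p (\<phi> x)}"
  proof
    show "p ` W \<subseteq> {p x..<p (\<phi> x)}" unfolding W_def by auto
    show "{p x..<p (\<phi> x)} \<subseteq> p ` W"
    proof
      fix t assume t: "t \<in> {p x..<p (\<phi> x)}"
      have "t \<in> p ` V" by (rule conv[of x "\<phi> x"]) (use t x AV BV phiB in auto)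
      then show "t \<in> p ` W" using t unfolding W_def by auto
    qed
  qed
  moreover have "inj_on p W" using inj unfolding W_def by (auto simp: inj_on_def)
  ultimately have cardW: "int (card W) = p (\<phi> x) - p x"
    using x(2) card_image[of p W] by simp
  have le: "p (\<phi> u) \<le> p (\<phi> v) \<longleftrightarrow> p u \<le> p v" if "u \<in> A" "v \<in> A" for u v
    using mono[OF that(2,1)] by linarith
  \<comment> \<open>A point of \<open>A\<close> in the window has its image at or beyond
    \<open>\<phi> x\<close>; a point of \<open>B\<close> in it has its preimage before
    \<open>x\<close>. Both come from right-moving points.\<close>
  have Wsub: "W \<subseteq> C \<union> ((R \<union> \<phi> ` R) \<inter> W)"
  proof
    fix z assume z: "z \<in> W"
    consider "z \<in> A" | "z \<in> B" | "z \<notin> A" "z \<notin> B" by blast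
    then show "z \<in> C \<union> ((R \<union> \<phi> ` R) \<inter> W)"
    proof cases
      case 1
      then have "p (\<phi> x) \<le> p (\<phi> z)" using le[OF x(1) 1] z unfolding W_def by auto
      then have "z \<in> R" using 1 z unfolding W_def R_def by auto
      then show ?thesis using z by auto
    next
      case 2
      then obtain u where u: "u \<in> A" "z = \<phi> u" using surj by auto
      then have "p u < p x" using z mono[OF u(1) x(1)] unfolding W_def by auto
      then have "u \<in> R" using u z unfolding W_def R_def by auto
      then show ?thesis using z u by auto
    next
      case 3
      then have "z \<noteq> x" using x by auto
      then have "p z \<noteq> p x" using inj z x AV unfolding W_def by (auto simp: inj_on_def)
      then show ?thesis using z 3 unfolding W_def C_def by auto
    qed
  qed
  have "\<phi> ` (R \<inter> L) = \<phi> ` R \<inter> L'"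
  proof
    show "\<phi> ` (R \<inter> L) \<subseteq> \<phi> ` R \<inter> L'"
      using mono[OF _ x(1)] BV phiB unfolding R_def L_def L'_def by auto
    show "\<phi> ` R \<inter> L' \<subseteq> \<phi> ` (R \<inter> L)"
      using mono[OF _ x(1)] AV unfolding R_def L_def L'_def by auto
  qed
  moreover have "inj_on \<phi> (R \<inter> L)" using injphi unfolding R_def by (auto simp: inj_on_def)
  ultimately have eq: "card (\<phi> ` R \<inter> L') = card (R \<inter> L)"
    using card_image[of \<phi> "R \<inter> L"] by simp
  \<comment> \<open>Preimages of right-moving points move right too, so a right-moving point before
    \<open>\<phi> x\<close> that is no such image belongs to \<open>F\<close>.\<close>
  have RB: "u \<in> \<phi> ` R" if "u \<in> R" "u \<in> B" for u
  proof -
    obtain w where w: "w \<in> A" "u = \<phi> w" using surj \<open>u \<in> B\<close> by auto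
    then show ?thesis using that mono[of w u] unfolding R_def by auto
  qed
  have "(R \<union> \<phi> ` R) \<inter> L' \<subseteq> F \<union> (\<phi> ` R \<inter> L')"
    using RB unfolding F_def R_def L'_def by auto
  then have 1: "card ((R \<union> \<phi> ` R) \<inter> L') \<le> card F + card (R \<inter> L)"
    using card_mono[of "F \<union> (\<phi> ` R \<inter> L')"] finsets finR eq card_Un_le[of F "\<phi> ` R \<inter> L'"]
    by (metis (no_types, lifting) finite_Int finite_Un order_trans)
  have "((R \<union> \<phi> ` R) \<inter> W) \<union> (R \<inter> L) \<subseteq> (R \<union> \<phi> ` R) \<inter> L'"
    using x unfolding W_def L_def L'_def by auto
  moreover have "((R \<union> \<phi> ` R) \<inter> W) \<inter> (R \<inter> L) = {}" unfolding W_def L_def by auto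
  ultimately have 2: "card ((R \<union> \<phi> ` R) \<inter> W) + card (R \<inter> L) \<le> card ((R \<union> \<phi> ` R) \<inter> L')"
    using finsets finR by (metis (no_types, lifting) card_Un_disjoint card_mono finite_Int)
  have "card W \<le> card C + card ((R \<union> \<phi> ` R) \<inter> W)"
    using card_mono[OF _ Wsub] finsets card_Un_le order_trans by (metis (no_types, lifting) finite_Int finite_Un)
  then have "card W \<le> card F + card C" using 1 2 by linarith
  then show ?thesis using cardW unfolding F_def C_def by linarith
qed

text \<open>The coordinates are abstract functions rather than position and value, so that
  exchanging or negating them gives further instances.\<close>

locale spread_shift =
  fixes V A B :: "'a set" and \<phi> :: "'a \<Rightarrow> 'a" and p q :: "'a \<Rightarrow> int" and k :: nat
  assumes fin: "finite V" and AV: "A \<subseteq> V" and BV: "B \<subseteq> V" and bij: "bij_betw \<phi> A B"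
    and card_compl: "card (V - B) = k"
    and inj_p: "inj_on p V" and inj_q: "inj_on q V"
    and conv_p: "\<And>u v t. \<lbrakk>u \<in> V; v \<in> V; p u \<le> t; t \<le> p v\<rbrakk> \<Longrightarrow> t \<in> p ` V"
    and conv_q: "\<And>u v t. \<lbrakk>u \<in> V; v \<in> V; q u \<le> t; t \<le> q v\<rbrakk> \<Longrightarrow> t \<in> q ` V"
    and mono_p: "\<And>u v. \<lbrakk>u \<in> A; v \<in> A\<rbrakk> \<Longrightarrow> p (\<phi> u) < p (\<phi> v) \<longleftrightarrow> p u < p v"
    and mono_q: "\<And>u v. \<lbrakk>u \<in> A; v \<in> A\<rbrakk> \<Longrightarrow> q (\<phi> u) < q (\<phi> v) \<longleftrightarrow> q u < q v"
    and dist: "\<And>u v. \<lbrakk>u \<in> V; v \<in> V; u \<noteq> v\<rbrakk> \<Longrightarrow> int k + 2 \<le> \<bar>p u - p v\<bar> + \<bar>q u - q v\<bar>"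
begin

section \<open>Points moving right and up, and the minimal ones among them\<close>

lemma phi_in: "u \<in> A \<Longrightarrow> \<phi> u \<in> B"
  using bij by (auto simp: bij_betw_def)

lemma phi_surj: "z \<in> B \<Longrightarrow> \<exists>u\<in>A. z = \<phi> u"
  using bij by (auto simp: bij_betw_def)

text \<open>Restricted to \<open>A - B\<close>, where a chain of points moving right and up ends
  when traced back along \<phi>.\<close>

definition starts :: "'a set" where
  "starts = {e \<in> A - B. p e < p (\<phi> e) \<and> q e < q (\<phi> e)}"

definition min_starts :: "'a set" where
  "min_starts = {m \<in> starts. \<forall>e\<in>starts. p e \<le> p m \<longrightarrow> q e \<le> q m \<longrightarrow> e = m}"

lemma starts_subset: "starts \<subseteq> A" "starts \<subseteq> V" "starts \<inter> B = {}"
  using AV unfolding starts_def by auto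

lemma finite_starts: "finite starts"
  using fin starts_subset finite_subset by blast

lemma min_starts_subset: "min_starts \<subseteq> starts"
  unfolding min_starts_def by auto

text \<open>Minimising \<open>p + q\<close> over the starts weakly below and to the left of
  \<open>e\<close> gives such an \<open>m\<close>.\<close>

lemma min_start_below:
  assumes "e \<in> starts"
  shows "\<exists>m\<in>min_starts. p m \<le> p e \<and> q m \<le> q e"
proof -
  define S where "S = {m \<in> starts. p m \<le> p e \<and> q m \<le> q e}"
  have "finite S" "S \<noteq> {}" using finite_starts assms unfolding S_def by auto
  then obtain m where m: "m \<in> S" "\<And>w. w \<in> S \<Longrightarrow> p m + q m \<le> p w + q w"
    using arg_min_least[of S _ "\<lambda>w. p w + q w"] arg_min_if_finite(1)[of S "\<lambda>w. p w + q w"] by blast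
  have "w = m" if "w \<in> starts" "p w \<le> p m" "q w \<le> q m" for w
  proof -
    have "w \<in> S" using that m(1) unfolding S_def by auto
    then have "p w = p m" using m(2)[of w] that by linarith
    then show ?thesis using inj_p that m(1) starts_subset unfolding S_def by (auto simp: inj_on_def)
  qed
  then show ?thesis using m(1) unfolding S_def min_starts_def by auto
qed

lemma min_starts_antichain:
  assumes "m \<in> min_starts" "m' \<in> min_starts" "m \<noteq> m'"
  shows "(p m < p m' \<and> q m' < q m) \<or> (p m' < p m \<and> q m < q m')"
proof -
  have "\<not> (p m \<le> p m' \<and> q m \<le> q m')" "\<not> (p m' \<le> p m \<and> q m' \<le> q m)"
    using assms unfolding min_starts_def by blast+
  then show ?thesis by linarith
qed

text \<open>Adds the bounds of \<open>displacement_le\<close> for \<open>p\<close> at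
  \<open>x\<close> and for \<open>q\<close> at \<open>x'\<close>. All counted points lie in
  \<open>V - B\<close>; the last two terms count those that occur twice.\<close>

lemma shift_sum_le:
  assumes x: "x \<in> A" "p x < p (\<phi> x)" and x': "x' \<in> A" "q x' < q (\<phi> x')"
  shows "p (\<phi> x) - p x + (q (\<phi> x') - q x') \<le> int k
    + int (card {e \<in> starts. p e < p (\<phi> x) \<and> q e < q (\<phi> x')})
    + int (card {z \<in> V - A - B. p x < p z \<and> p z < p (\<phi> x) \<and> q x' < q z \<and> q z < q (\<phi> x')})"
proof -
  define P where "P = {e \<in> A - B. p e < p (\<phi> e) \<and> p e < p (\<phi> x)}"
  define Q where "Q = {e \<in> A - B. q e < q (\<phi> e) \<and> q e < q (\<phi> x')}"
  define P' where "P' = {z \<in> V - A - B. p x < p z \<and> p z < p (\<phi> x)}"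
  define Q' where "Q' = {z \<in> V - A - B. q x' < q z \<and> q z < q (\<phi> x')}"
  have f: "finite P" "finite Q" "finite P'" "finite Q'"
    using fin AV finite_subset[of A V] unfolding P_def Q_def P'_def Q'_def by auto
  have 1: "p (\<phi> x) - p x \<le> int (card P) + int (card P')"
    unfolding P_def P'_def by (rule displacement_le[OF fin AV BV bij inj_p conv_p mono_p x])
  have 2: "q (\<phi> x') - q x' \<le> int (card Q) + int (card Q')"
    unfolding Q_def Q'_def by (rule displacement_le[OF fin AV BV bij inj_q conv_q mono_q x'])
  have 3: "card P + card Q = card (P \<union> Q) + card (P \<inter> Q)" using card_Un_Int f by blast
  have 4: "card P' + card Q' = card (P' \<union> Q') + card (P' \<inter> Q')" using card_Un_Int f by blast
  have "(P \<union> Q) \<inter> (P' \<union> Q') = {}" unfolding P_def Q_def P'_def Q'_def by auto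
  then have "card (P \<union> Q) + card (P' \<union> Q') = card ((P \<union> Q) \<union> (P' \<union> Q'))"
    using f by (simp add: card_Un_disjoint)
  also have "\<dots> \<le> card (V - B)"
    by (rule card_mono) (use fin AV in \<open>auto simp: P_def Q_def P'_def Q'_def\<close>)
  finally have 5: "card (P \<union> Q) + card (P' \<union> Q') \<le> k" using card_compl by simp
  have 6: "P \<inter> Q = {e \<in> starts. p e < p (\<phi> x) \<and> q e < q (\<phi> x')}"
    unfolding P_def Q_def starts_def by auto
  have 7: "P' \<inter> Q' = {z \<in> V - A - B. p x < p z \<and> p z < p (\<phi> x) \<and> q x' < q z \<and> q z < q (\<phi> x')}"
    unfolding P'_def Q'_def by auto
  show ?thesis using 1 2 3 4 5 unfolding 6 7 by linarith
qed

text \<open>With one coordinate nothing is counted twice: the two sets in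
  \<open>displacement_le\<close> are disjoint parts of \<open>V - B\<close>.\<close>

lemma shift_p_le:
  assumes x: "x \<in> A" "p x < p (\<phi> x)"
  shows "p (\<phi> x) - p x \<le> int k"
proof -
  define P where "P = {e \<in> A - B. p e < p (\<phi> e) \<and> p e < p (\<phi> x)}"
  define P' where "P' = {z \<in> V - A - B. p x < p z \<and> p z < p (\<phi> x)}"
  have f: "finite P" "finite P'"
    using fin AV finite_subset[of A V] unfolding P_def P'_def by auto
  have 1: "p (\<phi> x) - p x \<le> int (card P) + int (card P')"
    unfolding P_def P'_def by (rule displacement_le[OF fin AV BV bij inj_p conv_p mono_p x])
  have "P \<inter> P' = {}" unfolding P_def P'_def by auto
  then have "card P + card P' = card (P \<union> P')" using f by (simp add: card_Un_disjoint)
  also have "\<dots> \<le> card (V - B)"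
    by (rule card_mono) (use fin AV in \<open>auto simp: P_def P'_def\<close>)
  finally show ?thesis using 1 card_compl by simp
qed

lemma swap_coordinates: "spread_shift V A B \<phi> q p k"
proof unfold_locales
  show "int k + 2 \<le> \<bar>q u - q v\<bar> + \<bar>p u - p v\<bar>" if "u \<in> V" "v \<in> V" "u \<noteq> v" for u v
    using dist[OF that] by linarith
qed (fact fin AV BV bij card_compl inj_p inj_q conv_p conv_q mono_p mono_q)+

lemma shift_q_le: "\<lbrakk>x \<in> A; q x < q (\<phi> x)\<rbrakk> \<Longrightarrow> q (\<phi> x) - q x \<le> int k"
  using spread_shift.shift_p_le[OF swap_coordinates] .

text \<open>A point inside the box would be at distance at least \<open>k + 2\<close> from both corners, while the
  corners are at distance at most \<open>2 * k\<close>.\<close>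

lemma box_empty:
  assumes "x \<in> starts" "z \<in> V" "p x < p z" "p z < p (\<phi> x)" "q x < q z" "q z < q (\<phi> x)"
  shows False
proof -
  have x: "x \<in> A" "x \<in> V" "\<phi> x \<in> V" "p x < p (\<phi> x)" "q x < q (\<phi> x)"
    using assms(1) AV BV phi_in unfolding starts_def by auto
  have "x \<noteq> z" "\<phi> x \<noteq> z" using assms by auto
  then show False
    using dist[OF x(2) assms(2)] dist[OF x(3) assms(2)] shift_p_le[OF x(1,4)] shift_q_le[OF x(1,5)] assms by linarith
qed

lemma p_neq: "\<lbrakk>u \<in> V; v \<in> V; u \<noteq> v\<rbrakk> \<Longrightarrow> p u \<noteq> p v"
  using inj_p by (auto simp: inj_on_def)

lemma q_neq: "\<lbrakk>u \<in> V; v \<in> V; u \<noteq> v\<rbrakk> \<Longrightarrow> q u \<noteq> q v"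
  using inj_q by (auto simp: inj_on_def)

text \<open>The box between \<open>x\<close> and \<open>\<phi> x\<close> is empty and its corners
  are at distance at least \<open>k + 2\<close>, so the sum bound forces a second start below and to
  the left of \<open>\<phi> x\<close>.\<close>

lemma ex_other_min_start:
  assumes "x \<in> min_starts"
  shows "\<exists>m\<in>min_starts. m \<noteq> x \<and> p m < p (\<phi> x) \<and> q m < q (\<phi> x)"
proof -
  have xs: "x \<in> starts" using assms min_starts_subset by auto
  have x: "x \<in> A" "x \<in> V" "\<phi> x \<in> V" "p x < p (\<phi> x)" "q x < q (\<phi> x)"
    using xs AV BV phi_in unfolding starts_def by auto
  define S where "S = {e \<in> starts. p e < p (\<phi> x) \<and> q e < q (\<phi> x)}"
  have C: "{z \<in> V - A - B. p x < p z \<and> p z < p (\<phi> x) \<and> q x < q z \<and> q z < q (\<phi> x)} = {}"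
    using box_empty[OF xs] by blast
  have "p (\<phi> x) - p x + (q (\<phi> x) - q x) \<le> int k + int (card S)"
    using shift_sum_le[OF x(1,4) x(1,5)] unfolding S_def C card.empty by linarith
  moreover have "int k + 2 \<le> p (\<phi> x) - p x + (q (\<phi> x) - q x)"
  proof -
    have "x \<noteq> \<phi> x" using x by auto
    then show ?thesis using dist[OF x(2,3)] x by linarith
  qed
  ultimately have "2 \<le> card S" by linarith
  then have "\<not> S \<subseteq> {x}" using card_mono[of "{x}" S] by auto
  then obtain e where e: "e \<in> S" "e \<noteq> x" by auto
  obtain m where m: "m \<in> min_starts" "p m \<le> p e" "q m \<le> q e"
    using min_start_below e(1) unfolding S_def by blast
  have eV: "e \<in> V" using e starts_subset unfolding S_def by auto
  have "m \<noteq> x"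
  proof
    assume "m = x"
    then have "p x < p e" "q x < q e" using m p_neq[OF eV x(2) e(2)] q_neq[OF eV x(2) e(2)] by auto
    then show False using box_empty[OF xs eV] e unfolding S_def by auto
  qed
  then show ?thesis using m e unfolding S_def by (intro bexI[of _ m]) auto
qed

text \<open>Take \<open>x\<close> to be the rightmost minimal start that has another one to its right and below-left
  of \<open>\<phi> x\<close>; that other one can then only have such neighbours on its left.\<close>

lemma ex_mutual_min_starts:
  assumes "starts \<noteq> {}"
  shows "\<exists>x\<in>min_starts. \<exists>x'\<in>min_starts.
    p x < p x' \<and> p x' < p (\<phi> x) \<and> q x' < q x \<and> q x < q (\<phi> x')"
proof -
  define T where "T = {x \<in> min_starts. \<exists>m\<in>min_starts. p x < p m \<and> p m < p (\<phi> x) \<and> q m < q x}"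
  have finM: "finite min_starts" using finite_starts min_starts_subset finite_subset by blast
  have "min_starts \<noteq> {}" using min_start_below assms by blast
  then obtain l where l: "l \<in> min_starts" "\<And>m. m \<in> min_starts \<Longrightarrow> p l \<le> p m"
    using finM by (metis arg_min_least arg_min_if_finite(1))
  obtain m where m: "m \<in> min_starts" "m \<noteq> l" "p m < p (\<phi> l)"
    using ex_other_min_start[OF l(1)] by blast
  \<comment> \<open>Any minimal start other than the leftmost one lies to its right, hence
    lower.\<close>
  then have "l \<in> T" using min_starts_antichain[OF l(1) m(1)] l unfolding T_def by force
  moreover have "finite T" using finM unfolding T_def by auto
  ultimately obtain x where x: "x \<in> T" "\<And>w. w \<in> T \<Longrightarrow> p w \<le> p x"
    using arg_min_least[of T _ "\<lambda>w. - p w"] arg_min_if_finite(1)[of T "\<lambda>w. - p w"]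
    by (metis empty_iff neg_le_iff_le)
  then obtain x' where x': "x' \<in> min_starts" "p x < p x'" "p x' < p (\<phi> x)" "q x' < q x"
    unfolding T_def by blast
  have xM: "x \<in> min_starts" using x unfolding T_def by auto
  obtain e where e: "e \<in> min_starts" "e \<noteq> x'" "p e < p (\<phi> x')" "q e < q (\<phi> x')"
    using ex_other_min_start[OF x'(1)] by blast
  have "x' \<notin> T" using x(2) x'(2) by force
  then have e': "p e < p x'" "q x' < q e"
    using min_starts_antichain[OF e(1) x'(1) e(2)] e x' unfolding T_def by auto
  \<comment> \<open>Otherwise \<open>e\<close> lies to the right of \<open>x\<close>, so
    \<open>\<phi> e\<close> lies to the right of \<open>x'\<close>; then \<open>x'\<close> puts
    \<open>e\<close> into \<open>T\<close>, against the choice of \<open>x\<close>.\<close>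
  have "q x \<le> q e"
  proof (rule ccontr)
    assume "\<not> q x \<le> q e"
    then have pe: "p x < p e" using min_starts_antichain[OF e(1) xM] by force
    have "p (\<phi> x) < p (\<phi> e)"
      using mono_p pe e(1) xM min_starts_subset starts_subset by blast
    then have "e \<in> T" using e e' x' unfolding T_def by force
    then show False using x(2) pe by force
  qed
  then have "q x < q (\<phi> x')" using e by linarith
  then show ?thesis using xM x' by blast
qed

text \<open>For a mutual pair \<open>x\<close>, \<open>x'\<close> the counted starts are confined to
  the pair and two strips, whose widths leave a distance of at most \<open>k\<close> between
  \<open>x\<close> and \<open>x'\<close>.\<close>

lemma starts_empty: "starts = {}"
proof (rule ccontr)
  assume "starts \<noteq> {}"
  then obtain x x' where M: "x \<in> min_starts" "x' \<in> min_starts"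
    and r: "p x < p x'" "p x' < p (\<phi> x)" "q x' < q x" "q x < q (\<phi> x')"
    using ex_mutual_min_starts by blast
  have S: "x \<in> starts" "x' \<in> starts" using M min_starts_subset by auto
  have A: "x \<in> A" "x' \<in> A" "x \<in> V" "x' \<in> V" using S starts_subset by auto
  have mv: "p x < p (\<phi> x)" "q x' < q (\<phi> x')" using S unfolding starts_def by auto
  have phis: "p (\<phi> x) < p (\<phi> x')" "q (\<phi> x') < q (\<phi> x)" using mono_p mono_q A r by auto
  have close: "p x' - p x + (q x - q x') < 2 * int k"
    using shift_p_le[OF A(1) mv(1)] shift_q_le[OF A(2) mv(2)] r by linarith
  \<comment> \<open>The distances from \<open>z\<close> to the corners \<open>x\<close> and
    \<open>x'\<close> add up to the distance of the corners, which is below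
    \<open>2 * k\<close>.\<close>
  have between: False if "z \<in> V" "p x < p z" "p z < p x'" "q x' < q z" "q z < q x" for z
  proof -
    have "z \<noteq> x" "z \<noteq> x'" using that by auto
    then show False using dist[OF that(1) A(3)] dist[OF that(1) A(4)] close that by linarith
  qed
  have quadrant: "(q x < q z \<and> p z < p x) \<or> (p x' < p z \<and> q z < q x') \<or> (p z < p x \<and> q z < q x) \<or> (p z < p x' \<and> q z < q x')"
    if z: "z \<in> V" "z \<noteq> x" "z \<noteq> x'" "p z < p (\<phi> x)" "q z < q (\<phi> x')" for z
  proof -
    have ne: "p z \<noteq> p x" "p z \<noteq> p x'" "q z \<noteq> q x" "q z \<noteq> q x'" using p_neq q_neq z A by auto
    have "\<not> (p x < p z \<and> q x < q z)" using box_empty[OF S(1) z(1)] z phis by force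
    moreover have "\<not> (p x' < p z \<and> q x' < q z)" using box_empty[OF S(2) z(1)] z phis by force
    moreover have "\<not> (p x < p z \<and> p z < p x' \<and> q x' < q z \<and> q z < q x)" using between z(1) by blast
    ultimately show ?thesis using ne by linarith
  qed
  have C: "{z \<in> V - A - B. p x < p z \<and> p z < p (\<phi> x) \<and> q x' < q z \<and> q z < q (\<phi> x')} = {}"
    using quadrant A by force
  define U where "U = {z \<in> V. p x' < p z \<and> p z < p (\<phi> x)}"
  define L where "L = {z \<in> V. q x < q z \<and> q z < q (\<phi> x')}"
  \<comment> \<open>By minimality no other start lies below and to the left of \<open>x\<close> or
    \<open>x'\<close>.\<close>
  have "{e \<in> starts. p e < p (\<phi> x) \<and> q e < q (\<phi> x')} \<subseteq> {x, x'} \<union> (U \<union> L)"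
  proof
    fix e assume e: "e \<in> {e \<in> starts. p e < p (\<phi> x) \<and> q e < q (\<phi> x')}"
    show "e \<in> {x, x'} \<union> (U \<union> L)"
    proof (rule ccontr)
      assume n: "e \<notin> {x, x'} \<union> (U \<union> L)"
      have "e \<in> V" using e starts_subset by auto
      then have "(p e < p x \<and> q e < q x) \<or> (p e < p x' \<and> q e < q x')"
        using quadrant[of e] e n unfolding U_def L_def by auto
      then show False using M e n unfolding min_starts_def by force
    qed
  qed
  moreover have "finite ({x, x'} \<union> (U \<union> L))" using fin unfolding U_def L_def by auto
  ultimately have "card {e \<in> starts. p e < p (\<phi> x) \<and> q e < q (\<phi> x')} \<le> card ({x, x'} \<union> (U \<union> L))"
    by (rule card_mono[rotated])
  also have "\<dots> \<le> card {x, x'} + card (U \<union> L)" by (rule card_Un_le)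
  also have "\<dots> \<le> 2 + (card U + card L)" using card_Un_le[of U L] card_insert_le_m1[of 2 "{x'}" x] by simp
  finally have "int (card {e \<in> starts. p e < p (\<phi> x) \<and> q e < q (\<phi> x')}) \<le> 2 + int (card U) + int (card L)"
    by linarith
  moreover have "int (card U) \<le> p (\<phi> x) - p x' - 1" unfolding U_def by (rule card_between[OF inj_p r(2)])
  moreover have "int (card L) \<le> q (\<phi> x') - q x - 1" unfolding L_def by (rule card_between[OF inj_q r(4)])
  \<comment> \<open>The 2 for the pair cancels the \<open>- 1\<close> of each strip, leaving exactly
    \<open>k\<close>.\<close>
  ultimately have "p x' - p x + (q x - q x') \<le> int k"
    using shift_sum_le[OF A(1) mv(1) A(2) mv(2)] unfolding C card.empty by linarith
  moreover have "x \<noteq> x'" using r by auto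
  ultimately show False using dist[OF A(3,4)] r by linarith
qed

text \<open>The leftmost such point is not in \<open>B\<close>, since its preimage would be another
  one further left; so it would be a start.\<close>

lemma no_increasing_shift:
  assumes "x \<in> A" "p x < p (\<phi> x)" "q x < q (\<phi> x)"
  shows False
proof -
  define Q where "Q = {x \<in> A. p x < p (\<phi> x) \<and> q x < q (\<phi> x)}"
  have "finite Q" using finite_subset[OF AV fin] unfolding Q_def by auto
  moreover have "Q \<noteq> {}" using assms unfolding Q_def by auto
  ultimately obtain m where m: "m \<in> Q" "\<And>w. w \<in> Q \<Longrightarrow> p m \<le> p w"
    by (metis arg_min_least arg_min_if_finite(1))
  have "m \<in> B" using m(1) starts_empty unfolding Q_def starts_def by blast
  then obtain u where u: "u \<in> A" "m = \<phi> u" using phi_surj by blast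
  then have "u \<in> Q" "p u < p m"
    using mono_p[of u m] mono_q[of u m] m(1) unfolding Q_def by auto
  then show False using m(2) by force
qed

section \<open>Reflections of the coordinates\<close>

lemma reflect_p: "spread_shift V A B \<phi> (\<lambda>z. - p z) q k"
proof unfold_locales
  show "inj_on (\<lambda>z. - p z) V" using inj_p by (auto simp: inj_on_def)
  show "t \<in> (\<lambda>z. - p z) ` V" if "u \<in> V" "v \<in> V" "- p u \<le> t" "t \<le> - p v" for u v t
    using conv_p[OF that(2,1), of "- t"] that by (auto simp: image_iff) (metis minus_minus)
  show "int k + 2 \<le> \<bar>- p u - - p v\<bar> + \<bar>q u - q v\<bar>" if "u \<in> V" "v \<in> V" "u \<noteq> v" for u v
    using dist[OF that] by linarith
qed (fact fin AV BV bij card_compl inj_q conv_q mono_q | simp add: mono_p)+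

lemma reflect_q: "spread_shift V A B \<phi> p (\<lambda>z. - q z) k"
  by (rule spread_shift.swap_coordinates[OF spread_shift.reflect_p[OF swap_coordinates]])

text \<open>By injectivity a moved point changes both coordinates, and reflections turn each of the
  four directions into right and up.\<close>

theorem shift_trivial:
  assumes "x \<in> A"
  shows "\<phi> x = x"
proof (rule ccontr)
  assume "\<phi> x \<noteq> x"
  then have "p (\<phi> x) \<noteq> p x" "q (\<phi> x) \<noteq> q x"
    using p_neq q_neq assms AV BV phi_in by blast+
  then consider "p x < p (\<phi> x)" "q x < q (\<phi> x)" | "p x > p (\<phi> x)" "q x < q (\<phi> x)"
    | "p x < p (\<phi> x)" "q x > q (\<phi> x)" | "p x > p (\<phi> x)" "q x > q (\<phi> x)" by linarith
  then show False
    using no_increasing_shift[OF assms] spread_shift.no_increasing_shift[OF reflect_p assms]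
      spread_shift.no_increasing_shift[OF reflect_q assms]
      spread_shift.no_increasing_shift[OF spread_shift.reflect_q[OF reflect_p] assms]
    by cases auto
qed

end

section \<open>Patterns and breadth\<close>

text \<open>\<open>contained_in\<close> with the set of positions prescribed.\<close>

definition realizes :: "nat \<Rightarrow> (nat \<Rightarrow> nat) \<Rightarrow> nat set \<Rightarrow> (nat \<Rightarrow> nat) \<Rightarrow> bool" where
  "realizes r \<sigma> A \<pi> \<longleftrightarrow>
     (\<exists>f. f ` {1..r} = A \<and> strict_mono_on {1..r} f \<and>
          (\<forall>a\<in>{1..r}. \<forall>b\<in>{1..r}. \<sigma> (f a) < \<sigma> (f b) \<longleftrightarrow> \<pi> a < \<pi> b))"

section \<open>Ranks and the pattern of a set of positions\<close>

lemma strict_mono_on_less_iff_nat: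
  fixes f :: "nat \<Rightarrow> nat"
  assumes "strict_mono_on S f" "a \<in> S" "b \<in> S"
  shows "f a < f b \<longleftrightarrow> a < b"
  using strict_mono_onD[OF assms(1,2,3)] strict_mono_onD[OF assms(1,3,2)]
  by (cases a b rule: linorder_cases) auto

lemma rank_strict_mono_on:
  fixes f :: "nat \<Rightarrow> nat"
  assumes f: "strict_mono_on {1..r} f" and a: "a \<in> {1..r}"
  shows "card {z \<in> f ` {1..r}. z \<le> f a} = a"
proof -
  have "f b \<le> f a \<longleftrightarrow> b \<le> a" if "b \<in> {1..r}" for b
    using strict_mono_on_less_iff_nat[OF f a that] by linarith
  then have "{z \<in> f ` {1..r}. z \<le> f a} = f ` {1..a}" using a by auto
  moreover have "inj_on f {1..a}"
    by (rule inj_on_subset[OF strict_mono_on_imp_inj_on[OF f]]) (use a in auto)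
  ultimately show ?thesis by (simp add: card_image)
qed

text \<open>Both \<open>f a\<close> and \<open>g a\<close> have rank \<open>a\<close> in the common
  image, and rank is strictly increasing there.\<close>

lemma strict_mono_on_unique:
  fixes f g :: "nat \<Rightarrow> nat"
  assumes f: "strict_mono_on {1..r} f" and g: "strict_mono_on {1..r} g"
    and im: "f ` {1..r} = g ` {1..r}" and a: "a \<in> {1..r}"
  shows "f a = g a"
proof (rule ccontr)
  assume ne: "f a \<noteq> g a"
  define A where "A = f ` {1..r}"
  have A: "finite A" "f a \<in> A" "g a \<in> A" using im a unfolding A_def by auto
  have c: "card {z \<in> A. z \<le> f a} = a" "card {z \<in> A. z \<le> g a} = a"
    using rank_strict_mono_on[OF f a] rank_strict_mono_on[OF g a] im unfolding A_def by auto
  have "card {z \<in> A. z \<le> u} < card {z \<in> A. z \<le> v}" if "u < v" "v \<in> A" for u v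
  proof (rule psubset_card_mono)
    have "v \<in> {z \<in> A. z \<le> v} - {z \<in> A. z \<le> u}" using that by auto
    then have "{z \<in> A. z \<le> u} \<noteq> {z \<in> A. z \<le> v}" by blast
    moreover have "{z \<in> A. z \<le> u} \<subseteq> {z \<in> A. z \<le> v}" using that by auto
    ultimately show "{z \<in> A. z \<le> u} \<subset> {z \<in> A. z \<le> v}" by blast
  qed (use A in auto)
  then show False using ne c A by (metis less_irrefl linorder_neqE_nat)
qed

text \<open>Serves to recover a permutation from the mere order of its values.\<close>

lemma permutes_rank:
  fixes \<pi> :: "nat \<Rightarrow> nat"
  assumes \<pi>: "\<pi> permutes {1..r}" and a: "a \<in> {1..r}"
  shows "card {b \<in> {1..r}. \<pi> b \<le> \<pi> a} = \<pi> a"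
proof -
  have im: "\<pi> ` {1..r} = {1..r}" using \<pi> by (rule permutes_image)
  then have "\<pi> a \<in> {1..r}" using a by auto
  then have "\<pi> ` {b \<in> {1..r}. \<pi> b \<le> \<pi> a} = {1..\<pi> a}"
    using im by (auto simp: set_eq_iff image_iff) (metis atLeastAtMost_iff order_trans)+
  moreover have "inj_on \<pi> {b \<in> {1..r}. \<pi> b \<le> \<pi> a}"
    using permutes_inj[OF \<pi>] by (auto simp: inj_on_def)
  ultimately show ?thesis using card_image by (metis card_atLeastAtMost diff_Suc_1)
qed

text \<open>The increasing enumeration of \<open>A\<close> is unique, so both permutations have the
  value order of \<sigma> on \<open>A\<close>, and ranks determine them.\<close>

lemma realizes_unique:
  assumes "realizes r \<sigma> A \<pi>" "realizes r \<sigma> A \<rho>" "\<pi> \<in> Sym r" "\<rho> \<in> Sym r"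
  shows "\<pi> = \<rho>"
proof
  fix a
  obtain f g where f: "f ` {1..r} = A" "strict_mono_on {1..r} f"
      "\<forall>a\<in>{1..r}. \<forall>b\<in>{1..r}. \<sigma> (f a) < \<sigma> (f b) \<longleftrightarrow> \<pi> a < \<pi> b"
    and g: "g ` {1..r} = A" "strict_mono_on {1..r} g"
      "\<forall>a\<in>{1..r}. \<forall>b\<in>{1..r}. \<sigma> (g a) < \<sigma> (g b) \<longleftrightarrow> \<rho> a < \<rho> b"
    using assms(1,2) unfolding realizes_def by blast
  have fg: "f a = g a" if "a \<in> {1..r}" for a
    by (rule strict_mono_on_unique[OF f(2) g(2) _ that]) (simp only: f(1) g(1))
  have perm: "\<pi> permutes {1..r}" "\<rho> permutes {1..r}" using assms unfolding Sym_def by auto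
  show "\<pi> a = \<rho> a"
  proof (cases "a \<in> {1..r}")
    case True
    have "\<pi> a < \<pi> b \<longleftrightarrow> \<rho> a < \<rho> b" if "b \<in> {1..r}" for b
      using f(3) g(3) fg True that by metis
    then have "{b \<in> {1..r}. \<pi> b \<le> \<pi> a} = {b \<in> {1..r}. \<rho> b \<le> \<rho> a}"
      by (metis (no_types, lifting) linorder_not_le)
    then show ?thesis using permutes_rank[OF perm(1) True] permutes_rank[OF perm(2) True] by simp
  next
    case False
    then show ?thesis using perm by (auto simp: permutes_def)
  qed
qed

lemma ex_realizes:
  assumes fin: "finite A" and r: "card A = r" and inj: "inj_on \<sigma> A"
  shows "\<exists>\<pi>\<in>Sym r. realizes r \<sigma> A \<pi>"
proof -
  obtain h where h: "bij_betw h {..<r} A" "strict_mono_on {..<r} h"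
    using ex_bij_betw_strict_mono_card[OF fin] r by blast
  define f where "f i = h (i - 1)" for i
  have im: "f ` {1..r} = A"
  proof -
    have "(\<lambda>i. i - 1) ` {1..r} = {..<r}"
      by (auto simp: image_iff intro!: bexI[of _ "Suc _"])
    then have "f ` {1..r} = h ` {..<r}" unfolding f_def by (metis image_image)
    then show ?thesis using h(1) by (simp add: bij_betw_def)
  qed
  have mono: "strict_mono_on {1..r} f"
  proof (rule strict_mono_onI)
    fix a b assume "a \<in> {1..r}" "b \<in> {1..r}" "a < b"
    then show "f a < f b" unfolding f_def by (intro strict_mono_onD[OF h(2)]) auto
  qed
  \<comment> \<open>The standardisation of \<sigma> along \<open>f\<close>: values become ranks.
    Outside \<open>{1..r}\<close> it is the identity, as \<open>Sym\<close> requires.\<close>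
  define \<pi> where "\<pi> a = (if a \<in> {1..r} then card {b \<in> {1..r}. \<sigma> (f b) \<le> \<sigma> (f a)} else a)" for a
  have less: "\<pi> a < \<pi> b" if "a \<in> {1..r}" "b \<in> {1..r}" "\<sigma> (f a) < \<sigma> (f b)" for a b
  proof -
    have "card {c \<in> {1..r}. \<sigma> (f c) \<le> \<sigma> (f a)} < card {c \<in> {1..r}. \<sigma> (f c) \<le> \<sigma> (f b)}"
    proof (rule psubset_card_mono)
      have "b \<in> {c \<in> {1..r}. \<sigma> (f c) \<le> \<sigma> (f b)} - {c \<in> {1..r}. \<sigma> (f c) \<le> \<sigma> (f a)}"
        using that by auto
      then have "{c \<in> {1..r}. \<sigma> (f c) \<le> \<sigma> (f a)} \<noteq> {c \<in> {1..r}. \<sigma> (f c) \<le> \<sigma> (f b)}" by blast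
      moreover have "{c \<in> {1..r}. \<sigma> (f c) \<le> \<sigma> (f a)} \<subseteq> {c \<in> {1..r}. \<sigma> (f c) \<le> \<sigma> (f b)}"
        using that by auto
      ultimately show "{c \<in> {1..r}. \<sigma> (f c) \<le> \<sigma> (f a)} \<subset> {c \<in> {1..r}. \<sigma> (f c) \<le> \<sigma> (f b)}"
        by blast
    qed auto
    then show ?thesis using that by (simp add: \<pi>_def)
  qed
  have neq: "\<sigma> (f a) \<noteq> \<sigma> (f b)" if "a \<in> {1..r}" "b \<in> {1..r}" "a \<noteq> b" for a b
    using inj_onD[OF inj, of "f a" "f b"] inj_onD[OF strict_mono_on_imp_inj_on[OF mono], of a b] im that by blast
  have less_iff: "\<sigma> (f a) < \<sigma> (f b) \<longleftrightarrow> \<pi> a < \<pi> b" if "a \<in> {1..r}" "b \<in> {1..r}" for a b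
    using less[OF that] less[OF that(2,1)] neq[OF that] by (metis less_irrefl linorder_neqE_nat order_less_asym)
  have "inj_on \<pi> {1..r}"
    using less_iff neq by (intro inj_onI) (metis less_irrefl linorder_neqE_nat)
  moreover have "\<pi> ` {1..r} \<subseteq> {1..r}"
  proof (rule image_subsetI)
    fix a assume a: "a \<in> {1..r}"
    have "card {b \<in> {1..r}. \<sigma> (f b) \<le> \<sigma> (f a)} \<le> card {1..r}" by (rule card_mono) auto
    moreover have "0 < card {b \<in> {1..r}. \<sigma> (f b) \<le> \<sigma> (f a)}" using a by (auto simp: card_gt_0_iff)
    ultimately show "\<pi> a \<in> {1..r}" using a unfolding \<pi>_def by simp
  qed
  ultimately have "bij_betw \<pi> {1..r} {1..r}"
    by (simp add: bij_betw_def endo_inj_surj)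
  then have "\<pi> permutes {1..r}" by (rule bij_imp_permutes) (simp only: \<pi>_def if_False)
  then show ?thesis using im mono less_iff unfolding Sym_def realizes_def by blast
qed

section \<open>Reformulations of prolificity and breadth\<close>

lemma contained_in_iff_realizes:
  "contained_in r \<pi> n \<sigma> \<longleftrightarrow> (\<exists>A. A \<subseteq> {1..n} \<and> card A = r \<and> realizes r \<sigma> A \<pi>)"
proof
  assume "contained_in r \<pi> n \<sigma>"
  then obtain f where f: "f ` {1..r} \<subseteq> {1..n}" "strict_mono_on {1..r} f"
      "\<forall>a\<in>{1..r}. \<forall>b\<in>{1..r}. \<sigma> (f a) < \<sigma> (f b) \<longleftrightarrow> \<pi> a < \<pi> b"
    unfolding contained_in_def by blast
  moreover have "card (f ` {1..r}) = r"
    using card_image[OF strict_mono_on_imp_inj_on[OF f(2)]] by simp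
  ultimately show "\<exists>A. A \<subseteq> {1..n} \<and> card A = r \<and> realizes r \<sigma> A \<pi>"
    unfolding realizes_def by blast
next
  assume "\<exists>A. A \<subseteq> {1..n} \<and> card A = r \<and> realizes r \<sigma> A \<pi>"
  then obtain f where "f ` {1..r} \<subseteq> {1..n}" "strict_mono_on {1..r} f"
      "\<forall>a\<in>{1..r}. \<forall>b\<in>{1..r}. \<sigma> (f a) < \<sigma> (f b) \<longleftrightarrow> \<pi> a < \<pi> b"
    unfolding realizes_def by auto
  then show "contained_in r \<pi> n \<sigma>" unfolding contained_in_def by blast
qed

text \<open>The contained patterns are the image under \<open>pat\<close> of
  \<open>n choose k\<close> sets, so they number \<open>n choose k\<close> exactly if
  \<open>pat\<close> is injective.\<close>

lemma prolific_iff_realizes_inj: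
  assumes "k \<le> n" and \<sigma>: "\<sigma> \<in> Sym n"
  shows "prolific k n \<sigma> \<longleftrightarrow>
    (\<forall>A B \<pi>. A \<subseteq> {1..n} \<longrightarrow> card A = n - k \<longrightarrow> B \<subseteq> {1..n} \<longrightarrow> card B = n - k \<longrightarrow> \<pi> \<in> Sym (n - k) \<longrightarrow>
      realizes (n - k) \<sigma> A \<pi> \<longrightarrow> realizes (n - k) \<sigma> B \<pi> \<longrightarrow> A = B)"
proof -
  define r where "r = n - k"
  define S where "S = {A. A \<subseteq> {1..n} \<and> card A = r}"
  have "finite S" unfolding S_def by auto
  have "\<exists>\<pi>\<in>Sym r. realizes r \<sigma> A \<pi>" if "A \<in> S" for A
  proof (rule ex_realizes)
    show "finite A" using that finite_subset unfolding S_def by blast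
    show "inj_on \<sigma> A" using \<sigma> permutes_inj unfolding Sym_def by (blast intro: inj_on_subset)
  qed (use that in \<open>simp add: S_def\<close>)
  then obtain pat where pat: "pat A \<in> Sym r" "realizes r \<sigma> A (pat A)" if "A \<in> S" for A
    by metis
  have pat_eq: "pat A = \<pi>" if "A \<in> S" "\<pi> \<in> Sym r" "realizes r \<sigma> A \<pi>" for A \<pi>
    using realizes_unique pat that by blast
  have "{\<pi> \<in> Sym r. contained_in r \<pi> n \<sigma>} = pat ` S"
    using pat pat_eq unfolding contained_in_iff_realizes S_def by blast
  moreover have "card S = n choose k"
    using n_subsets[of "{1..n}" r] binomial_symmetric[OF \<open>k \<le> n\<close>] unfolding S_def r_def by simp
  ultimately have "prolific k n \<sigma> \<longleftrightarrow> card (pat ` S) = card S"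
    unfolding prolific_def r_def[symmetric] by simp
  also have "\<dots> \<longleftrightarrow> inj_on pat S" using \<open>finite S\<close> by (simp add: inj_on_iff_eq_card)
  also have "\<dots> \<longleftrightarrow> (\<forall>A\<in>S. \<forall>B\<in>S. \<forall>\<pi>\<in>Sym r. realizes r \<sigma> A \<pi> \<longrightarrow> realizes r \<sigma> B \<pi> \<longrightarrow> A = B)"
    using pat pat_eq unfolding inj_on_def by metis
  finally show ?thesis unfolding S_def r_def by blast
qed

lemma breadth_ge_iff:
  assumes "n > 1"
  shows "d \<le> breadth n \<sigma> \<longleftrightarrow> (\<forall>i\<in>{1..n}. \<forall>j\<in>{1..n}. i \<noteq> j \<longrightarrow> d \<le> entry_dist \<sigma> i j)"
proof -
  define D where "D = {entry_dist \<sigma> i j | i j. i \<in> {1..n} \<and> j \<in> {1..n} \<and> i \<noteq> j}"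
  have "D \<subseteq> (\<lambda>(i, j). entry_dist \<sigma> i j) ` ({1..n} \<times> {1..n})" unfolding D_def by auto
  then have "finite D" using finite_subset by blast
  moreover have "entry_dist \<sigma> 1 n \<in> D" using assms unfolding D_def by force
  ultimately have "d \<le> breadth n \<sigma> \<longleftrightarrow> (\<forall>e\<in>D. d \<le> e)"
    unfolding breadth_def D_def[symmetric] by (subst Min_ge_iff) auto
  then show ?thesis unfolding D_def by blast
qed

text \<open>No element of \<open>K\<close> separates \<open>i\<close> from \<open>j\<close>, so
  replacing \<open>i\<close> by \<open>j\<close> in the enumeration preserves all
  comparisons.\<close>

lemma realizes_swap:
  assumes "realizes r \<sigma> (insert i K) \<pi>" "i \<notin> K" "j \<notin> K"
    and "\<And>z. z \<in> K \<Longrightarrow> (z < i \<longleftrightarrow> z < j) \<and> (\<sigma> z < \<sigma> i \<longleftrightarrow> \<sigma> z < \<sigma> j)"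
    and inj: "inj \<sigma>"
  shows "realizes r \<sigma> (insert j K) \<pi>"
proof -
  obtain f where f: "f ` {1..r} = insert i K" "strict_mono_on {1..r} f"
      "\<forall>a\<in>{1..r}. \<forall>b\<in>{1..r}. \<sigma> (f a) < \<sigma> (f b) \<longleftrightarrow> \<pi> a < \<pi> b"
    using assms(1) unfolding realizes_def by blast
  define s where "s z = (if z = i then j else z)" for z
  have gt: "(i < z \<longleftrightarrow> j < z) \<and> (\<sigma> i < \<sigma> z \<longleftrightarrow> \<sigma> j < \<sigma> z)" if "z \<in> K" for z
  proof -
    have "z \<noteq> i" "z \<noteq> j" using that assms by auto
    moreover have "\<sigma> z \<noteq> \<sigma> i" "\<sigma> z \<noteq> \<sigma> j" using inj_eq[OF inj] calculation by auto
    ultimately show ?thesis using assms(4)[OF that] by linarith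
  qed
  have s: "(s z < s w \<longleftrightarrow> z < w) \<and> (\<sigma> (s z) < \<sigma> (s w) \<longleftrightarrow> \<sigma> z < \<sigma> w)"
    if "z \<in> insert i K" "w \<in> insert i K" for z w
    using that assms(4) gt unfolding s_def by auto
  have "s ` insert i K = insert j K" using assms(2) unfolding s_def by auto
  then have "(s \<circ> f) ` {1..r} = insert j K" using f(1) by (metis image_comp)
  moreover have fi: "f a \<in> insert i K" if "a \<in> {1..r}" for a using f(1) that by blast
  moreover have "strict_mono_on {1..r} (s \<circ> f)"
  proof (rule strict_mono_onI)
    fix a b assume ab: "a \<in> {1..r}" "b \<in> {1..r}" "a < b"
    then show "(s \<circ> f) a < (s \<circ> f) b"
      using s[OF fi fi] strict_mono_onD[OF f(2)] by simp
  qed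
  moreover have "\<sigma> ((s \<circ> f) a) < \<sigma> ((s \<circ> f) b) \<longleftrightarrow> \<pi> a < \<pi> b" if "a \<in> {1..r}" "b \<in> {1..r}" for a b
    using s[OF fi[OF that(1)] fi[OF that(2)]] f(3) that by simp
  ultimately show ?thesis unfolding realizes_def by blast
qed

section \<open>Close entries give two sets with one pattern\<close>

lemma close_imp_not_prolific:
  assumes k: "1 \<le> k" "k < n" and \<sigma>: "\<sigma> \<in> Sym n"
    and ij: "i \<in> {1..n}" "j \<in> {1..n}" "i \<noteq> j" and close: "entry_dist \<sigma> i j < int k + 2"
  shows "\<not> prolific k n \<sigma>"
proof -
  define P where "P = {z \<in> {1..n}. min i j < z \<and> z < max i j}"
  define Q where "Q = {z \<in> {1..n}. min (\<sigma> i) (\<sigma> j) < \<sigma> z \<and> \<sigma> z < max (\<sigma> i) (\<sigma> j)}"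
  have perm: "\<sigma> permutes {1..n}" using \<sigma> unfolding Sym_def by simp
  have inj: "inj \<sigma>" using perm by (rule permutes_inj)
  then have ne: "\<sigma> i \<noteq> \<sigma> j" using ij inj_eq by metis
  have "card P \<le> card {min i j<..<max i j}" by (rule card_mono) (auto simp: P_def)
  then have cP: "int (card P) \<le> \<bar>int i - int j\<bar> - 1" using ij(3) by (auto simp: min_def max_def split: if_splits)
  have "card Q \<le> card {min (\<sigma> i) (\<sigma> j)<..<max (\<sigma> i) (\<sigma> j)}"
    by (rule card_inj_on_le[where f = \<sigma>]) (use inj in \<open>auto simp: Q_def intro: inj_on_subset\<close>)
  then have cQ: "int (card Q) \<le> \<bar>int (\<sigma> i) - int (\<sigma> j)\<bar> - 1" using ne by (auto simp: min_def max_def split: if_splits)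
  \<comment> \<open>The two counts sum to at most the distance minus 2, and the distance is at most
    \<open>k + 1\<close>.\<close>
  have PQ: "card (P \<union> Q) \<le> k - 1"
    using card_Un_le[of P Q] cP cQ close k unfolding entry_dist_def by linarith
  have sub: "P \<union> Q \<subseteq> {1..n} - {i, j}" unfolding P_def Q_def by auto
  have cij: "card ({1..n} - {i, j}) = n - 2" using ij by (simp add: card_Diff_subset)
  \<comment> \<open>Pads the separating entries to exactly \<open>k - 1\<close> deletions;
    \<open>k < n\<close> leaves room for this beside \<open>i\<close> and \<open>j\<close>.\<close>
  obtain D where D: "P \<union> Q \<subseteq> D" "D \<subseteq> {1..n} - {i, j}" "card D = k - 1"
  proof -
    have "k - 1 \<le> card ({1..n} - {i, j})" using cij k by linarith
    moreover have "finite ({1..n} - {i, j})" by simp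
    ultimately show thesis using exists_subset_between[OF PQ _ sub] that by blast
  qed
  define K where "K = {1..n} - {i, j} - D"
  have finK: "finite K" unfolding K_def by auto
  have cK: "card K = n - k - 1"
    using card_Diff_subset[of D "{1..n} - {i, j}"] D cij k finite_subset[OF D(2)] unfolding K_def by auto
  have nK: "i \<notin> K" "j \<notin> K" "K \<subseteq> {1..n}" unfolding K_def by auto
  have swap: "(z < i \<longleftrightarrow> z < j) \<and> (\<sigma> z < \<sigma> i \<longleftrightarrow> \<sigma> z < \<sigma> j)" if "z \<in> K" for z
  proof -
    have "z \<noteq> i" "z \<noteq> j" "z \<in> {1..n}" "z \<notin> P" "z \<notin> Q" using that D(1) unfolding K_def by auto
    moreover have "\<sigma> z \<noteq> \<sigma> i" "\<sigma> z \<noteq> \<sigma> j" using inj_eq[OF inj] calculation by auto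
    ultimately show ?thesis unfolding P_def Q_def by (auto simp: min_def max_def split: if_splits)
  qed
  have cards: "card (insert i K) = n - k" "card (insert j K) = n - k" using nK cK finK k by auto
  obtain \<pi> where \<pi>: "\<pi> \<in> Sym (n - k)" "realizes (n - k) \<sigma> (insert i K) \<pi>"
    using ex_realizes[OF _ cards(1), of \<sigma>] finK inj by (meson finite_insert inj_on_subset subset_UNIV)
  have "realizes (n - k) \<sigma> (insert j K) \<pi>"
    by (rule realizes_swap[OF \<pi>(2) nK(1,2) swap inj])
  moreover have "insert i K \<noteq> insert j K" using nK ij by auto
  moreover have "insert i K \<subseteq> {1..n}" "insert j K \<subseteq> {1..n}" using nK ij by auto
  ultimately show ?thesis
    using prolific_iff_realizes_inj[OF less_imp_le[OF k(2)] \<sigma>] cards \<pi> by blast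
qed

section \<open>Spread entries make the pattern map injective\<close>

lemma spread_imp_realizes_inj:
  assumes \<sigma>: "\<sigma> permutes {1..n}" and "k \<le> n"
    and spread: "\<forall>i\<in>{1..n}. \<forall>j\<in>{1..n}. i \<noteq> j \<longrightarrow> int k + 2 \<le> entry_dist \<sigma> i j"
    and A: "A \<subseteq> {1..n}" "realizes (n - k) \<sigma> A \<pi>" and B: "B \<subseteq> {1..n}" "card B = n - k" "realizes (n - k) \<sigma> B \<pi>"
  shows "A = B"
proof -
  define r where "r = n - k"
  obtain f g where f: "f ` {1..r} = A" "strict_mono_on {1..r} f"
      "\<forall>a\<in>{1..r}. \<forall>b\<in>{1..r}. \<sigma> (f a) < \<sigma> (f b) \<longleftrightarrow> \<pi> a < \<pi> b"
    and g: "g ` {1..r} = B" "strict_mono_on {1..r} g"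
      "\<forall>a\<in>{1..r}. \<forall>b\<in>{1..r}. \<sigma> (g a) < \<sigma> (g b) \<longleftrightarrow> \<pi> a < \<pi> b"
    using A(2) B(3) unfolding realizes_def r_def by blast
  have bf: "bij_betw f {1..r} A" and bg: "bij_betw g {1..r} B"
    using f g strict_mono_on_imp_inj_on unfolding bij_betw_def by blast+
  \<comment> \<open>Sends the \<open>a\<close>-th element of \<open>A\<close> to the
    \<open>a\<close>-th of \<open>B\<close>; the common pattern makes it respect values too.\<close>
  define \<phi> where "\<phi> = g \<circ> the_inv_into {1..r} f"
  have \<phi>f: "\<phi> (f a) = g a" if "a \<in> {1..r}" for a
    using that the_inv_into_f_f[of f "{1..r}"] bf unfolding \<phi>_def bij_betw_def by simp
  have bij: "bij_betw \<phi> A B"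
    unfolding \<phi>_def by (rule bij_betw_trans[OF bij_betw_the_inv_into[OF bf] bg])
  have mono: "\<phi> u < \<phi> v \<longleftrightarrow> u < v" "\<sigma> (\<phi> u) < \<sigma> (\<phi> v) \<longleftrightarrow> \<sigma> u < \<sigma> v" if uv: "u \<in> A" "v \<in> A" for u v
  proof -
    obtain a b where ab: "a \<in> {1..r}" "b \<in> {1..r}" "u = f a" "v = f b"
      using uv unfolding f(1)[symmetric] by blast
    show "\<phi> u < \<phi> v \<longleftrightarrow> u < v"
      using ab \<phi>f strict_mono_on_less_iff_nat[OF f(2)] strict_mono_on_less_iff_nat[OF g(2)] by simp
    show "\<sigma> (\<phi> u) < \<sigma> (\<phi> v) \<longleftrightarrow> \<sigma> u < \<sigma> v" using ab \<phi>f f(3) g(3) by simp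
  qed
  have im: "(\<lambda>z. int (\<sigma> z)) ` {1..n} = int ` {1..n}"
    using permutes_image[OF \<sigma>] by (metis image_image)
  have interval: "t \<in> int ` {1..n}" if "u \<in> {1..n}" "v \<in> {1..n}" "int u \<le> t" "t \<le> int v" for u v t
    using that by (intro image_eqI[of _ _ "nat t"]) auto
  have compl: "card ({1..n} - B) = k"
    using card_Diff_subset[of B "{1..n}"] B finite_subset[OF B(1)] \<open>k \<le> n\<close> by auto
  \<comment> \<open>Positions serve as \<open>p\<close>, values as \<open>q\<close>; both fill an
    interval.\<close>
  interpret spread_shift "{1..n}" A B \<phi> int "\<lambda>z. int (\<sigma> z)" k
  proof unfold_locales
    show "inj_on (\<lambda>z. int (\<sigma> z)) {1..n}" using permutes_inj[OF \<sigma>] by (auto simp: inj_on_def)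
    show "t \<in> (\<lambda>z. int (\<sigma> z)) ` {1..n}"
      if "u \<in> {1..n}" "v \<in> {1..n}" "int (\<sigma> u) \<le> t" "t \<le> int (\<sigma> v)" for u v t
      using interval[of "\<sigma> u" "\<sigma> v" t] that permutes_in_image[OF \<sigma>] unfolding im by blast
    show "int k + 2 \<le> \<bar>int u - int v\<bar> + \<bar>int (\<sigma> u) - int (\<sigma> v)\<bar>"
      if "u \<in> {1..n}" "v \<in> {1..n}" "u \<noteq> v" for u v
      using spread that unfolding entry_dist_def by blast
  qed (fact A(1) B(1) bij compl interval finite_atLeastAtMost inj_on_of_nat | simp add: mono)+
  have "\<phi> ` A = A" using shift_trivial by simp
  then show ?thesis using bij unfolding bij_betw_def by simp
qed

theorem theorem2p25:
  fixes n k :: nat and \<sigma> :: "nat \<Rightarrow> nat"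
  assumes "1 \<le> k" and "k < n" and "\<sigma> \<in> Sym n"
  shows "prolific k n \<sigma> \<longleftrightarrow> breadth n \<sigma> \<ge> int k + 2"
proof
  assume "prolific k n \<sigma>"
  then show "breadth n \<sigma> \<ge> int k + 2"
    using close_imp_not_prolific[OF assms] assms breadth_ge_iff[of n "int k + 2" \<sigma>]
    by (meson not_le le_less_trans)
next
  assume "breadth n \<sigma> \<ge> int k + 2"
  moreover have "n > 1" using assms by simp
  ultimately have "\<forall>i\<in>{1..n}. \<forall>j\<in>{1..n}. i \<noteq> j \<longrightarrow> int k + 2 \<le> entry_dist \<sigma> i j"
    using breadth_ge_iff by blast
  moreover have "\<sigma> permutes {1..n}" using assms(3) by (simp add: Sym_def)
  ultimately show "prolific k n \<sigma>"
    using prolific_iff_realizes_inj[OF less_imp_le[OF assms(2)] assms(3)]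
      spread_imp_realizes_inj[OF _ less_imp_le[OF assms(2)]] by blast
qed

end
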